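(* Let $G=(V,E)$ be a $3$-connected circuit in $M^*(2,2)$ with no non-trivial $3$-edge-cutsets and $|V|\geq 6$. Then $G$ has (at least) two admissible nodes.
   Context: Graphs are finite and simple (no loops, no multiple edges). A circuit in $M^*(2,2)$ (briefly, a circuit) is a graph $G=(V,E)$ with $|E|=2|V|-1$ such that every proper subgraph $H=(V',E')$ of $G$ (with $V'\neq\emptyset$) satisfies $|E'|\leq 2|V'|-2$. A non-trivial $3$-edge-cutset is a set of $3$ edges whose removal separates the graph into two components each having at least two vertices. A node is a vertex of degree $3$. For a vertex $v$, $N(v)$ is its set of neighbours. For a node $v$ and two distinct neighbours $u,w\in N(v)$, $G_v^{uw}$ is obtained from $G$ by removing $v$ (with its incident edges) and adding a new edge $uw$ (if $uw\in E$ already, the result is not a simple graph, hence not a circuit). For a circuit $G$ and a node $v$, the pair of edges $uv,wv$ is admissible if $G_v^{uw}$ is a circuit; the node $v$ is admissible if $uv,wv$ is admissible for some distinct $u,w\in N(v)$. *)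

theory Defs
  imports Main
begin

text \<open>
  A graph is given by its vertex set \<open>V\<close> and its edge set \<open>E\<close>; an edge is the
  two-element set of its ends, so loops and multiple edges cannot occur.
\<close>

definition simple_graph :: "'a set \<Rightarrow> 'a set set \<Rightarrow> bool" where
  "simple_graph V E \<longleftrightarrow> finite V \<and> (\<forall>e\<in>E. e \<subseteq> V \<and> card e = 2)"

definition subgraph :: "'a set \<Rightarrow> 'a set set \<Rightarrow> 'a set \<Rightarrow> 'a set set \<Rightarrow> bool" where
  "subgraph V' E' V E \<longleftrightarrow> simple_graph V' E' \<and> V' \<subseteq> V \<and> E' \<subseteq> E"

definition proper_subgraph :: "'a set \<Rightarrow> 'a set set \<Rightarrow> 'a set \<Rightarrow> 'a set set \<Rightarrow> bool" where
  "proper_subgraph V' E' V E \<longleftrightarrow> subgraph V' E' V E \<and> \<not> (V' = V \<and> E' = E)"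

text \<open>
  A circuit in \<open>M\<^sup>*(2,2)\<close>. The conditions \<open>|E| = 2|V| - 1\<close> and \<open>|E'| \<le> 2|V'| - 2\<close> are
  written without subtraction, which truncates on \<^typ>\<open>nat\<close>.
\<close>

definition circuit :: "'a set \<Rightarrow> 'a set set \<Rightarrow> bool" where
  "circuit V E \<longleftrightarrow> simple_graph V E \<and> card E + 1 = 2 * card V \<and>
     (\<forall>V' E'. proper_subgraph V' E' V E \<and> V' \<noteq> {} \<longrightarrow> card E' + 2 \<le> 2 * card V')"

definition neighbours :: "'a set set \<Rightarrow> 'a \<Rightarrow> 'a set" where
  "neighbours E v = {u. {u, v} \<in> E}"

definition degree :: "'a set set \<Rightarrow> 'a \<Rightarrow> nat" where
  "degree E v = card {e \<in> E. v \<in> e}"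

definition node :: "'a set \<Rightarrow> 'a set set \<Rightarrow> 'a \<Rightarrow> bool" where
  "node V E v \<longleftrightarrow> v \<in> V \<and> degree E v = 3"

definition linked :: "'a set set \<Rightarrow> ('a \<times> 'a) set" where
  "linked E = {(x, y). {x, y} \<in> E}\<^sup>*"

definition connected_graph :: "'a set \<Rightarrow> 'a set set \<Rightarrow> bool" where
  "connected_graph V E \<longleftrightarrow> V \<noteq> {} \<and> (\<forall>x\<in>V. \<forall>y\<in>V. (x, y) \<in> linked E)"

definition components_graph :: "'a set \<Rightarrow> 'a set set \<Rightarrow> 'a set set" where
  "components_graph V E = V // (linked E \<inter> V \<times> V)"

definition k_connected :: "nat \<Rightarrow> 'a set \<Rightarrow> 'a set set \<Rightarrow> bool" where
  "k_connected k V E \<longleftrightarrow> k < card V \<and>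
     (\<forall>X. X \<subseteq> V \<and> card X < k \<longrightarrow> connected_graph (V - X) {e \<in> E. e \<inter> X = {}})"

definition nontrivial_3_edge_cutset :: "'a set \<Rightarrow> 'a set set \<Rightarrow> 'a set set \<Rightarrow> bool" where
  "nontrivial_3_edge_cutset V E F \<longleftrightarrow> F \<subseteq> E \<and> card F = 3 \<and>
     card (components_graph V (E - F)) = 2 \<and>
     (\<forall>C \<in> components_graph V (E - F). 2 \<le> card C)"

text \<open>
  The edge set of \<open>G\<^sub>v\<^sup>u\<^sup>w\<close>, whose vertex set is \<open>V - {v}\<close>. If \<open>uw\<close> is already an edge of \<open>G\<close>,
  the set cannot record the resulting double edge; the condition \<open>{u, w} \<notin> E\<close> in
  \<open>admissible_pair\<close> excludes that case, in which the multigraph is not a circuit.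
\<close>

definition reduced_edges :: "'a set set \<Rightarrow> 'a \<Rightarrow> 'a \<Rightarrow> 'a \<Rightarrow> 'a set set" where
  "reduced_edges E v u w = insert {u, w} {e \<in> E. v \<notin> e}"

definition admissible_pair :: "'a set \<Rightarrow> 'a set set \<Rightarrow> 'a \<Rightarrow> 'a \<Rightarrow> 'a \<Rightarrow> bool" where
  "admissible_pair V E v u w \<longleftrightarrow> {u, w} \<notin> E \<and> circuit (V - {v}) (reduced_edges E v u w)"

definition admissible_node :: "'a set \<Rightarrow> 'a set set \<Rightarrow> 'a \<Rightarrow> bool" where
  "admissible_node V E v \<longleftrightarrow> node V E v \<and>
     (\<exists>u \<in> neighbours E v. \<exists>w \<in> neighbours E v. u \<noteq> w \<and> admissible_pair V E v u w)"

end

theory Submission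
  imports Defs
begin

text \<open>
  Write \<open>i(X)\<close> for the number of edges induced by \<open>X\<close>, and call a nonempty \<open>X \<subset> V\<close> tight if
  \<open>i(X) = 2|X| - 2\<close>, the largest value that sparsity allows. Since \<open>i\<close> is supermodular, two
  intersecting tight sets that do not cover \<open>V\<close> have a tight union, and no edge joins their
  differences (\<open>tight_Un\<close>).

  A node \<open>v\<close> that is not admissible is blocked in one of two ways (\<open>non_admissible_cases\<close>). Either
  its neighbourhood is a triangle, so that \<open>v\<close> and its neighbours form a \<open>K\<^sub>4\<close>; or each pair of its
  neighbours lies in a tight set that avoids \<open>v\<close> and the third neighbour. The mixed cases contradict
  \<open>tight_Un\<close> or 3-connectivity. In the second case any two of the three tight sets cover \<open>V - {v}\<close>,
  so the neighbours of \<open>v\<close> are pairwise nonadjacent. In particular a node next to such a \<open>v\<close> is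
  admissible unless it is itself blocked by tight sets.

  The deficit \<open>\<Sum>x\<in>X. 4 - deg x\<close> locates nodes: it is \<open>2\<close> on \<open>V\<close>, and a node contributes \<open>1\<close>
  while every other vertex contributes at most \<open>0\<close>. A tight set \<open>X\<close> with \<open>2 \<le> |X| \<le> |V| - 2\<close> has
  deficit at most \<open>0\<close>, for otherwise its complement would be tight too and three edges would separate
  the two. Suppose that no node outside such a set \<open>X\<close> is blocked by tight sets. Since every \<open>K\<^sub>4\<close> of
  the first kind merges with any such tight set that it meets but that misses its node
  (\<open>clique_Un_nontrivial_tight\<close>), \<open>X\<close> and all nodes blocked by cliques can be swallowed by a disjoint union
  of tight sets, of deficit at most \<open>0\<close>. The rest of \<open>V\<close> has deficit at least \<open>2\<close>, hence contains
  two nodes, and both are admissible (\<open>two_admissible_nodes_outside\<close>).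

  The nodes blocked by tight sets induce a forest. If there are none, the previous paragraph applied
  to \<open>X = {}\<close> gives the two admissible nodes. Otherwise take such a node \<open>v\<close> with at most one neighbour
  of the same kind. For each of two neighbours \<open>u\<close> not of this kind, the complement of \<open>v\<close> and
  of the tight set that misses \<open>u\<close> is a part containing \<open>u\<close>, and the two parts are disjoint. Each part
  contains an admissible node, by induction on its size (\<open>admissible_node_in_part\<close>): a leaf, within
  the part, of the forest allows the part to be replaced by a smaller one that still contains a
  vertex outside the forest, until the part avoids the forest or is a single node next to it.
\<close>

section \<open>Counting induced edges\<close>

lemma two_distinct:
  assumes "2 \<le> card A"
  obtains a b where "a \<in> A" "b \<in> A" "a \<noteq> b"
proof -
  obtain T where "T \<subseteq> A" "card T = 2" using obtain_subset_with_card_n[OF assms] by blast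
  then show ?thesis using that by (auto simp: card_2_iff)
qed

locale circuit_graph =
  fixes V :: "'a set" and E :: "'a set set"
  assumes is_circuit: "circuit V E"
begin

abbreviation N :: "'a \<Rightarrow> 'a set" where "N \<equiv> neighbours E"

definition induced :: "'a set \<Rightarrow> 'a set set" where
  "induced X = {e \<in> E. e \<subseteq> X}"

definition edges_in :: "'a set \<Rightarrow> int" where
  "edges_in X = int (card (induced X))"

definition cross :: "'a set \<Rightarrow> 'a set \<Rightarrow> 'a set set" where
  "cross X Y = {e \<in> E. e \<subseteq> X \<union> Y \<and> \<not> e \<subseteq> X \<and> \<not> e \<subseteq> Y}"

text \<open>
  Singletons are tight. The set \<^term>\<open>V\<close> is excluded because it exceeds the bound by one.
\<close>

definition tight :: "'a set \<Rightarrow> bool" where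
  "tight X \<longleftrightarrow> X \<subseteq> V \<and> X \<noteq> {} \<and> X \<noteq> V \<and> edges_in X = 2 * int (card X) - 2"

lemma finite_V [simp]: "finite V"
  using is_circuit by (simp add: circuit_def simple_graph_def)

lemma edge_subset: "e \<in> E \<Longrightarrow> e \<subseteq> V"
  using is_circuit by (simp add: circuit_def simple_graph_def)

lemma edge_card: "e \<in> E \<Longrightarrow> card e = 2"
  using is_circuit by (simp add: circuit_def simple_graph_def)

lemma finite_E [simp]: "finite E"
  by (rule finite_subset[of E "Pow V"]) (auto dest: edge_subset)

lemma finite_sub [simp]: "X \<subseteq> V \<Longrightarrow> finite X"
  using finite_subset finite_V by blast

lemma finite_induced [simp]: "finite (induced X)"
  by (simp add: induced_def)

lemma edge_ends:
  assumes "e \<in> E"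
  obtains x y where "e = {x, y}" "x \<noteq> y" "x \<in> V" "y \<in> V"
proof -
  obtain x y where "e = {x, y}" "x \<noteq> y"
    using edge_card[OF assms] by (auto simp: card_2_iff)
  with edge_subset[OF assms] show ?thesis by (intro that) auto
qed

lemma no_loop: "{x, y} \<in> E \<Longrightarrow> x \<noteq> y"
  using edge_card[of "{x, y}"] by auto

lemma neighbours_subset: "N v \<subseteq> V"
  using edge_subset by (auto simp: neighbours_def)

lemma neighbours_sym: "u \<in> N v \<longleftrightarrow> v \<in> N u"
  by (simp add: neighbours_def insert_commute)

lemma not_self_neighbour: "v \<notin> N v"
  using no_loop[of v v] by (auto simp: neighbours_def)

lemma finite_N [simp]: "finite (N v)"
  using finite_sub[OF neighbours_subset] .

lemma inj_edge: "inj_on (\<lambda>u. {u, v}) A"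
  by (auto simp: inj_on_def doubleton_eq_iff)

lemma degree_eq: "degree E v = card (N v)"
proof -
  have "{e \<in> E. v \<in> e} = (\<lambda>u. {u, v}) ` N v"
  proof
    show "{e \<in> E. v \<in> e} \<subseteq> (\<lambda>u. {u, v}) ` N v"
    proof
      fix e assume e: "e \<in> {e \<in> E. v \<in> e}"
      then obtain x y where "e = {x, y}" using edge_ends by blast
      with e obtain u where "e = {u, v}" "e \<in> E" by blast
      then show "e \<in> (\<lambda>u. {u, v}) ` N v" by (auto simp: neighbours_def)
    qed
  qed (auto simp: neighbours_def)
  then show ?thesis by (simp add: degree_def card_image[OF inj_edge])
qed

lemma edges_in_insert:
  assumes "v \<notin> X"
  shows "edges_in (insert v X) = edges_in X + int (card (N v \<inter> X))"
proof -
  let ?A = "(\<lambda>u. {u, v}) ` (N v \<inter> X)"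
  have "induced (insert v X) = induced X \<union> ?A"
  proof
    show "induced (insert v X) \<subseteq> induced X \<union> ?A"
    proof
      fix e assume e: "e \<in> induced (insert v X)"
      then have "e \<in> E" by (simp add: induced_def)
      then obtain x y where xy: "e = {x, y}" "x \<noteq> y" by (rule edge_ends)
      show "e \<in> induced X \<union> ?A"
      proof (cases "v \<in> e")
        case True
        then obtain u where "e = {u, v}" "u \<noteq> v" using xy by auto
        then show ?thesis using e by (auto simp: induced_def neighbours_def)
      qed (use e in \<open>auto simp: induced_def\<close>)
    qed
  qed (auto simp: induced_def neighbours_def)
  moreover have "induced X \<inter> ?A = {}" using assms by (auto simp: induced_def)
  ultimately have "card (induced (insert v X)) = card (induced X) + card ?A"
    by (simp add: card_Un_disjoint)
  then show ?thesis by (simp add: edges_in_def card_image[OF inj_edge])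
qed

lemma edges_in_empty [simp]: "edges_in {} = 0"
proof -
  have "induced {} = {}" using edge_card by (force simp: induced_def)
  then show ?thesis by (simp add: edges_in_def)
qed

lemma edges_in_nonneg: "edges_in X \<ge> 0"
  by (simp add: edges_in_def)

text \<open>
  The supermodularity of \<^term>\<open>edges_in\<close>, with its exact error term: the edges of the union that
  neither set contains.
\<close>

lemma edges_in_Un_Int:
  "edges_in (X \<union> Y) + edges_in (X \<inter> Y) = edges_in X + edges_in Y + int (card (cross X Y))"
proof -
  have 1: "induced (X \<union> Y) = (induced X \<union> induced Y) \<union> cross X Y"
    by (auto simp: induced_def cross_def)
  have 2: "(induced X \<union> induced Y) \<inter> cross X Y = {}"
    by (auto simp: induced_def cross_def)
  have 3: "induced (X \<inter> Y) = induced X \<inter> induced Y" by (auto simp: induced_def)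
  have "finite (cross X Y)" by (simp add: cross_def)
  then have "card (induced (X \<union> Y)) = card (induced X \<union> induced Y) + card (cross X Y)"
    unfolding 1 using 2 by (intro card_Un_disjoint) auto
  moreover have "card (induced X) + card (induced Y)
      = card (induced X \<union> induced Y) + card (induced (X \<inter> Y))"
    unfolding 3 by (intro card_Un_Int) auto
  ultimately show ?thesis by (simp add: edges_in_def)
qed

lemma cross_edge: "{a, b} \<in> E \<Longrightarrow> a \<in> X - Y \<Longrightarrow> b \<in> Y - X \<Longrightarrow> {a, b} \<in> cross X Y"
  by (auto simp: cross_def)

lemma edges_in_V: "edges_in V = 2 * int (card V) - 1"
proof -
  have "induced V = E" using edge_subset by (auto simp: induced_def)
  then show ?thesis using is_circuit by (simp add: edges_in_def circuit_def)
qed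

text \<open>
  The sparsity condition on subgraphs amounts to one on vertex sets, because the induced subgraph
  has the most edges among those on a given vertex set.
\<close>

lemma sparse:
  assumes "X \<subseteq> V" "X \<noteq> {}" "X \<noteq> V"
  shows "edges_in X \<le> 2 * int (card X) - 2"
proof -
  have "simple_graph X (induced X)"
    using assms edge_card by (auto simp: simple_graph_def induced_def)
  then have "proper_subgraph X (induced X) V E"
    using assms by (auto simp: proper_subgraph_def subgraph_def induced_def)
  then have "card (induced X) + 2 \<le> 2 * card X"
    using is_circuit assms unfolding circuit_def by blast
  then show ?thesis by (simp add: edges_in_def)
qed

lemma dense_eq_V:
  "X \<subseteq> V \<Longrightarrow> X \<noteq> {} \<Longrightarrow> edges_in X \<ge> 2 * int (card X) - 1 \<Longrightarrow> X = V"
  using sparse[of X] by linarith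

lemma tightI:
  "X \<subseteq> V \<Longrightarrow> X \<noteq> {} \<Longrightarrow> X \<noteq> V \<Longrightarrow> edges_in X \<ge> 2 * int (card X) - 2 \<Longrightarrow> tight X"
  using sparse[of X] by (simp add: tight_def)

lemma tightD:
  assumes "tight X"
  shows "X \<subseteq> V" "X \<noteq> {}" "X \<noteq> V" "edges_in X = 2 * int (card X) - 2" "finite X"
  using assms by (auto simp: tight_def)

lemma card_Un_Int_int:
  "X \<subseteq> V \<Longrightarrow> Y \<subseteq> V \<Longrightarrow> int (card X) + int (card Y) = int (card (X \<union> Y)) + int (card (X \<inter> Y))"
  using card_Un_Int[of X Y] by simp

lemma card_compl_int: "X \<subseteq> V \<Longrightarrow> int (card (V - X)) = int (card V) - int (card X)"
  by (simp add: card_Diff_subset card_mono of_nat_diff)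

section \<open>Tight sets and deficits\<close>

text \<open>
  The bounds for the union and the intersection add up to exactly what the two tight sets provide, so
  both are attained and no crossing edge is left over.
\<close>

lemma tight_Un:
  assumes "tight X" "tight Y" "X \<inter> Y \<noteq> {}" "X \<union> Y \<noteq> V"
  shows "tight (X \<union> Y)" "tight (X \<inter> Y)" "cross X Y = {}"
proof -
  note X = tightD[OF assms(1)] and Y = tightD[OF assms(2)]
  have u: "edges_in (X \<union> Y) \<le> 2 * int (card (X \<union> Y)) - 2"
    using X Y assms by (intro sparse) auto
  have i: "edges_in (X \<inter> Y) \<le> 2 * int (card (X \<inter> Y)) - 2"
    using X Y assms by (intro sparse) auto
  note s = edges_in_Un_Int[of X Y] card_Un_Int_int[OF X(1) Y(1)]
  show "tight (X \<union> Y)" using X Y assms u i s by (intro tightI) auto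
  show "tight (X \<inter> Y)" using X Y assms u i s by (intro tightI) auto
  have "card (cross X Y) = 0" using X Y u i s by linarith
  moreover have "finite (cross X Y)" by (simp add: cross_def)
  ultimately show "cross X Y = {}" by simp
qed

text \<open>
  When two tight sets cover \<^term>\<open>V\<close>, the surplus edge of \<^term>\<open>V\<close> lets a nonempty
  intersection fall short of being tight by one, or lets one edge run between the differences.
\<close>

lemma tight_Un_eq_V:
  assumes "tight X" "tight Y" "X \<union> Y = V"
  shows "edges_in (X \<inter> Y) = 2 * int (card (X \<inter> Y)) - 3 + int (card (cross X Y))"
proof -
  note X = tightD[OF assms(1)] and Y = tightD[OF assms(2)]
  show ?thesis
    using edges_in_Un_Int[of X Y] card_Un_Int_int[OF X(1) Y(1)] X(4) Y(4) edges_in_V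
    unfolding assms(3) by linarith
qed

lemma tight_insert:
  assumes "tight X" "v \<in> V - X" "card (N v \<inter> X) \<ge> 2" "insert v X \<noteq> V"
  shows "tight (insert v X)"
  using tightD[OF assms(1)] assms edges_in_insert[of v X] by (intro tightI) auto

lemma tight_contains_neighbours:
  assumes "tight X" "v \<in> V - X" "card (N v \<inter> X) \<ge> 3"
  shows "insert v X = V"
  using tightD[OF assms(1)] assms edges_in_insert[of v X] by (intro dense_eq_V) auto

text \<open>
  Edges inside \<^term>\<open>X\<close> are counted twice and edges leaving it once; the latter are those that
  neither \<^term>\<open>X\<close> nor its complement induces.
\<close>

lemma sum_degree:
  assumes "X \<subseteq> V"
  shows "(\<Sum>x\<in>X. int (degree E x)) = edges_in X + edges_in V - edges_in (V - X)"
proof -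
  have "finite X" using assms by simp
  then show ?thesis using assms
  proof (induction X rule: finite_induct)
    case (insert x X)
    define R where "R = V - insert x X"
    have X: "V - X = insert x R" "x \<notin> R" using insert by (auto simp: R_def)
    have r: "edges_in (V - X) = edges_in R + int (card (N x \<inter> R))"
      unfolding X(1) by (rule edges_in_insert[OF X(2)])
    have "N x = (N x \<inter> X) \<union> (N x \<inter> R)"
      using neighbours_subset[of x] not_self_neighbour[of x] by (auto simp: R_def)
    then have "card (N x) = card (N x \<inter> X) + card (N x \<inter> R)"
      using card_Un_disjoint[of "N x \<inter> X" "N x \<inter> R"] by (auto simp: R_def)
    then have "int (degree E x) + (edges_in X + edges_in V - edges_in (V - X))
        = edges_in (insert x X) + edges_in V - edges_in R"
      using r edges_in_insert[OF insert.hyps(2)] by (simp add: degree_eq)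
    then show ?case
      using insert unfolding R_def by simp
  qed simp
qed

text \<open>
  Vertices have degree at least 3, so a positive deficit forces the presence of that many nodes.
\<close>

definition deficit :: "'a set \<Rightarrow> int" where
  "deficit X = (\<Sum>x\<in>X. 4 - int (degree E x))"

lemma deficit_eq:
  "X \<subseteq> V \<Longrightarrow> deficit X = 4 * int (card X) - edges_in X - edges_in V + edges_in (V - X)"
  by (simp add: deficit_def sum_subtractf sum_degree)

lemma deficit_V: "deficit V = 2"
  by (simp add: deficit_eq edges_in_V)

lemma deficit_Un: "X \<subseteq> V \<Longrightarrow> Y \<subseteq> V \<Longrightarrow> X \<inter> Y = {} \<Longrightarrow> deficit (X \<union> Y) = deficit X + deficit Y"
  unfolding deficit_def by (intro sum.union_disjoint) auto

lemma edges_in_delete: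
  assumes "v \<in> V" shows "edges_in V = edges_in (V - {v}) + int (degree E v)"
proof -
  have "N v \<inter> (V - {v}) = N v" using neighbours_subset not_self_neighbour by blast
  then show ?thesis using edges_in_insert[of v "V - {v}"] assms by (simp add: insert_absorb degree_eq)
qed

lemma degree_ge_3:
  assumes "v \<in> V" "card V \<ge> 2"
  shows "degree E v \<ge> 3"
proof -
  have "card (V - {v}) > 0" using assms by simp
  then have "V - {v} \<noteq> {}" by force
  then have "edges_in (V - {v}) \<le> 2 * int (card (V - {v})) - 2"
    using assms by (intro sparse) auto
  then show ?thesis
    using edges_in_delete[OF assms(1)] edges_in_V card_compl_int[of "{v}"] assms by simp
qed

lemma sum_inner_degree:
  assumes "X \<subseteq> V"
  shows "(\<Sum>x\<in>X. int (card (N x \<inter> X))) = 2 * edges_in X"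
proof -
  have "finite X" using assms by simp
  then show ?thesis using assms
  proof (induction X rule: finite_induct)
    case (insert x X)
    have "int (card (N y \<inter> insert x X)) = int (card (N y \<inter> X)) + (if y \<in> N x then 1 else 0)"
      if "y \<in> X" for y
      using insert.hyps neighbours_sym[of y x] by (auto simp: Int_insert_right)
    then have "(\<Sum>y\<in>X. int (card (N y \<inter> insert x X)))
        = (\<Sum>y\<in>X. int (card (N y \<inter> X))) + (\<Sum>y\<in>X. if y \<in> N x then 1 else 0)"
      by (simp add: sum.distrib)
    also have "(\<Sum>y\<in>X. if y \<in> N x then 1 else 0 :: int) = int (card (N x \<inter> X))"
      using insert.hyps by (simp add: sum.If_cases Int_commute)
    finally show ?case
      using insert not_self_neighbour[of x] edges_in_insert[of x X] by simp
  qed simp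
qed

text \<open>
  A set of nodes induces a forest: deleting \<^term>\<open>W\<close> removes \<open>3|W| - i(W)\<close> edges, and if
  \<open>i(W) \<ge> |W|\<close>, that is at most \<open>2|W|\<close>, which leaves too many edges on the remaining vertices. Only
  the existence of a vertex of degree at most 1 in this forest matters below.
\<close>

lemma node_with_few_neighbours_in:
  assumes "W \<subseteq> V" "W \<noteq> {}" "W \<noteq> V" "\<And>w. w \<in> W \<Longrightarrow> node V E w"
  obtains p where "p \<in> W" "card (N p \<inter> W) \<le> 1"
proof -
  have "\<exists>p\<in>W. card (N p \<inter> W) \<le> 1"
  proof (rule ccontr)
    assume "\<not> ?thesis"
    then have ge2: "\<And>p. p \<in> W \<Longrightarrow> 2 \<le> card (N p \<inter> W)" by force
    have "edges_in (V - W) \<le> 2 * int (card (V - W)) - 2"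
      using assms by (intro sparse) auto
    moreover have "(\<Sum>x\<in>W. int (degree E x)) = 3 * int (card W)"
      using assms(4) by (simp add: node_def)
    moreover have "2 * int (card W) \<le> 2 * edges_in W"
      using sum_mono[of W "\<lambda>_. 2" "\<lambda>x. int (card (N x \<inter> W))"] ge2 sum_inner_degree[OF assms(1)]
      by simp
    ultimately show False
      using sum_degree[OF assms(1)] edges_in_V card_compl_int[OF assms(1)] by linarith
  qed
  then show ?thesis using that by blast
qed

lemma cross_emptyI:
  assumes "\<And>a b. a \<in> X - Y \<Longrightarrow> b \<in> Y - X \<Longrightarrow> {a, b} \<notin> E"
  shows "cross X Y = {}"
proof (rule ccontr)
  assume "cross X Y \<noteq> {}"
  then obtain e where e: "e \<in> E" "e \<subseteq> X \<union> Y" "\<not> e \<subseteq> X" "\<not> e \<subseteq> Y" by (auto simp: cross_def)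
  obtain x y where xy: "e = {x, y}" using edge_ends[OF e(1)] by metis
  have "x \<in> X - Y \<and> y \<in> Y - X \<or> y \<in> X - Y \<and> x \<in> Y - X" using e xy by auto
  then show False using assms[of x y] assms[of y x] e(1) xy by (auto simp: insert_commute)
qed

lemma edges_in_upper: "X \<subseteq> V \<Longrightarrow> 2 * edges_in X \<le> int (card X) * (int (card X) - 1)"
proof -
  assume X: "X \<subseteq> V"
  have "int (card (N x \<inter> X)) \<le> int (card X) - 1" if "x \<in> X" for x
  proof -
    have "N x \<inter> X \<subseteq> X - {x}" using not_self_neighbour by auto
    then have "card (N x \<inter> X) \<le> card (X - {x})" using X by (intro card_mono) auto
    moreover have "card X \<ge> 1" using that X by (metis One_nat_def Suc_leI card_gt_0_iff empty_iff finite_sub)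
    ultimately show ?thesis using that X by simp
  qed
  then have "(\<Sum>x\<in>X. int (card (N x \<inter> X))) \<le> (\<Sum>x\<in>X. int (card X) - 1)" by (rule sum_mono)
  then show ?thesis using sum_inner_degree[OF X] by simp
qed

text \<open>
  A simple graph on two or three vertices has too few edges to be tight.
\<close>

lemma tight_card: "tight X \<Longrightarrow> card X = 1 \<or> card X \<ge> 4"
proof -
  assume t: "tight X"
  have "card X > 0" using tightD[OF t] by (simp add: card_gt_0_iff)
  moreover have "card X \<noteq> 2 \<and> card X \<noteq> 3"
    using edges_in_upper[OF tightD(1)[OF t]] tightD(4)[OF t] by auto
  ultimately show ?thesis by linarith
qed

text \<open>
  Splitting a tight set along a partition without connecting edges would lose two edges from the bound.
\<close>

lemma tight_connected:
  assumes "tight X" "R \<subseteq> X" "R \<noteq> {}" "R \<noteq> X"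
  obtains a b where "a \<in> R" "b \<in> X - R" "{a, b} \<in> E"
proof (rule ccontr)
  assume no: "\<not> thesis"
  note X = tightD[OF assms(1)]
  have "cross R (X - R) = {}" using no that by (intro cross_emptyI) auto
  moreover have "R \<union> (X - R) = X" "R \<inter> (X - R) = {}" using assms by auto
  moreover have "edges_in R \<le> 2 * int (card R) - 2" using X assms by (intro sparse) auto
  moreover have "edges_in (X - R) \<le> 2 * int (card (X - R)) - 2" using X assms by (intro sparse) auto
  moreover have "int (card (X - R)) = int (card X) - int (card R)"
    using X assms by (simp add: card_Diff_subset card_mono finite_subset of_nat_diff)
  ultimately show False using edges_in_Un_Int[of R "X - R"] X(4) by simp
qed

section \<open>Blocked nodes\<close>

definition tight_blocked :: "'a \<Rightarrow> bool" where
  "tight_blocked v \<longleftrightarrow> node V E v \<and>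
     (\<forall>u\<in>N v. \<exists>S. tight S \<and> v \<notin> S \<and> S \<inter> N v = N v - {u})"

definition clique_blocked :: "'a \<Rightarrow> bool" where
  "clique_blocked v \<longleftrightarrow> node V E v \<and> (\<forall>u\<in>N v. \<forall>w\<in>N v. u \<noteq> w \<longrightarrow> {u, w} \<in> E)"

lemma tight_blocked_node: "tight_blocked v \<Longrightarrow> node V E v"
  by (simp add: tight_blocked_def)

lemma node_card_N: "node V E v \<Longrightarrow> card (N v) = 3"
  by (simp add: node_def degree_eq)

text \<open>
  The two sets share the third neighbour of \<^term>\<open>v\<close>, so their union is tight; it contains all
  three neighbours of \<^term>\<open>v\<close>, and adding \<^term>\<open>v\<close> with its three edges exceeds the bound for
  anything but \<^term>\<open>V\<close>.
\<close>

lemma blocking_sets_cover: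
  assumes "node V E v" "a \<in> N v" "b \<in> N v" "a \<noteq> b"
    and S: "tight S" "v \<notin> S" "S \<inter> N v = N v - {a}"
    and T: "tight T" "v \<notin> T" "T \<inter> N v = N v - {b}"
  shows "S \<union> T = V - {v}" "{a, b} \<notin> E"
proof -
  have v: "v \<in> V" using assms by (simp add: node_def)
  have "card (N v - {a, b}) = 1"
    using node_card_N assms(1-4) by (simp add: card_Diff_subset)
  then have "N v - {a, b} \<noteq> {}" by force
  then obtain c where "c \<in> N v - {a, b}" by blast
  then have "S \<inter> T \<noteq> {}" using S T by auto
  moreover have "S \<union> T \<noteq> V" using v S T by auto
  ultimately have t: "tight (S \<union> T)" "cross S T = {}" using tight_Un S T by blast+
  have "N v \<subseteq> S \<union> T" using S T assms(4) by auto
  then have "N v \<inter> (S \<union> T) = N v" by auto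
  then have "insert v (S \<union> T) = V"
    using tight_contains_neighbours[OF t(1), of v] v S T node_card_N[OF assms(1)] by auto
  then show "S \<union> T = V - {v}" using S T by auto
  have "a \<in> T - S" "b \<in> S - T" using S T assms(2-4) by auto
  then show "{a, b} \<notin> E" using cross_edge[of b a S T] t(2) by (auto simp: insert_commute)
qed

lemma tight_blocked_no_triangle:
  assumes "tight_blocked v" "a \<in> N v" "b \<in> N v" "a \<noteq> b"
  shows "{a, b} \<notin> E"
  using assms blocking_sets_cover(2)[of v a b] unfolding tight_blocked_def by metis

lemma clique_blocked_not_adjacent:
  assumes "clique_blocked y" "tight_blocked p" shows "y \<notin> N p"
proof
  assume y: "y \<in> N p"
  have p: "p \<in> N y" using y neighbours_sym by blast
  have "card (N y) = 3" using assms(1) node_card_N by (simp add: clique_blocked_def)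
  then have "card (N y - {p}) = 2" using p by simp
  then have "N y - {p} \<noteq> {}" by force
  then obtain t where t: "t \<in> N y" "t \<noteq> p" by blast
  then have "{t, p} \<in> E" using assms(1) p by (simp add: clique_blocked_def)
  then have "t \<in> N p" by (simp add: neighbours_def)
  moreover have "{t, y} \<in> E" using t by (simp add: neighbours_def)
  ultimately show False
    using tight_blocked_no_triangle[OF assms(2)] y no_loop by blast
qed

lemma tight_delete_node: "v \<in> V \<Longrightarrow> tight (V - {v}) \<Longrightarrow> node V E v"
  using edges_in_delete[of v] edges_in_V tightD(4)[of "V - {v}"] card_compl_int[of "{v}"]
  by (simp add: node_def)

text \<open>
  The reduced graph has the right number of edges, so it fails to be a circuit only because of a
  subgraph with too many edges. This subgraph uses the new edge, and without it spans a tight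
  set. The third neighbour of \<^term>\<open>v\<close> cannot belong to that set, since otherwise adding
  \<^term>\<open>v\<close> would give all of \<^term>\<open>V\<close> and the subgraph would not be proper.
\<close>

lemma non_admissible_pair_obstruction:
  assumes v: "node V E v" and uw: "u \<in> N v" "w \<in> N v" "u \<noteq> w"
    and "\<not> admissible_pair V E v u w"
  shows "{u, w} \<in> E \<or> (\<exists>S. tight S \<and> v \<notin> S \<and> S \<inter> N v = {u, w})"
proof (cases "{u, w} \<in> E")
  case False
  define V0 where "V0 = V - {v}"
  define R where "R = reduced_edges E v u w"
  have vV: "v \<in> V" and deg: "degree E v = 3" using v by (auto simp: node_def)
  have uwV: "u \<in> V" "w \<in> V" "v \<noteq> u" "v \<noteq> w"
    using uw neighbours_subset not_self_neighbour by auto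
  have ind: "induced V0 = {e \<in> E. v \<notin> e}" using edge_subset by (auto simp: induced_def V0_def)
  then have R: "R = insert {u, w} (induced V0)" by (simp add: R_def reduced_edges_def)
  have "simple_graph V0 R"
    using edge_card uwV uw(3) by (auto simp: simple_graph_def R induced_def V0_def)
  moreover have cV0: "edges_in V0 = 2 * int (card V0) - 2"
    using edges_in_delete[OF vV] deg edges_in_V card_compl_int[of "{v}"] vV by (simp add: V0_def)
  have "{u, w} \<notin> induced V0" using False by (simp add: induced_def)
  then have "int (card R) = 2 * int (card V0) - 1" using cV0 by (simp add: R edges_in_def)
  then have "card R + 1 = 2 * card V0" by simp
  moreover have "\<not> circuit V0 R"
    using assms(5) False by (simp add: admissible_pair_def V0_def R_def)
  ultimately obtain V' E' where p: "proper_subgraph V' E' V0 R" "V' \<noteq> {}"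
      and dense: "\<not> card E' + 2 \<le> 2 * card V'"
    unfolding circuit_def by blast
  have sub: "V' \<subseteq> V0" "E' \<subseteq> R" "\<And>e. e \<in> E' \<Longrightarrow> e \<subseteq> V'" and ne: "\<not> (V' = V0 \<and> E' = R)"
    using p by (auto simp: proper_subgraph_def subgraph_def simple_graph_def)
  have V': "V' \<subseteq> V" "V' \<noteq> V" "v \<notin> V'" using sub(1) vV by (auto simp: V0_def)
  let ?D = "E' - {{u, w}}"
  have D: "?D \<subseteq> induced V'"
  proof
    fix e assume "e \<in> ?D"
    then have "e \<in> E" "e \<subseteq> V'" using sub(2) sub(3)[of e] by (auto simp: R induced_def)
    then show "e \<in> induced V'" by (simp add: induced_def)
  qed
  then have Dle: "int (card ?D) \<le> edges_in V'" by (simp add: edges_in_def card_mono)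
  have finE': "finite E'" using sub(2) R by (metis finite_induced finite_insert finite_subset)
  have le: "edges_in V' \<le> 2 * int (card V') - 2" using sparse V' p(2) by blast
  have mem: "{u, w} \<in> E'"
  proof (rule ccontr)
    assume "{u, w} \<notin> E'"
    then have "?D = E'" by auto
    then show False using Dle le dense by simp
  qed
  then have cD: "int (card ?D) = int (card E') - 1"
    using finE' by (simp add: card_Diff_singleton)
      (metis One_nat_def Suc_leI card_gt_0_iff empty_iff of_nat_1 of_nat_diff)
  have t: "tight V'" using V' p(2) Dle cD dense by (intro tightI) auto
  have uw': "u \<in> V'" "w \<in> V'" using sub(3)[OF mem] by auto
  have "\<not> N v \<subseteq> V'"
  proof
    assume "N v \<subseteq> V'"
    then have "N v \<inter> V' = N v" by auto
    then have "insert v V' = V"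
      using tight_contains_neighbours[OF t, of v] vV V' node_card_N[OF v] by auto
    then have VV: "V' = V0" using V' by (auto simp: V0_def)
    have "card (induced V0) \<le> card ?D" using cV0 cD dense VV by (simp add: edges_in_def)
    then have "?D = induced V0" using D VV by (intro card_seteq) auto
    then have "E' = R" using mem R by auto
    then show False using VV ne by simp
  qed
  then obtain z where z: "z \<in> N v" "z \<notin> V'" by auto
  have "z \<noteq> u" "z \<noteq> w" using z uw' by blast+
  then have "card {u, w, z} = 3" using uw by simp
  then have "{u, w, z} = N v" using z uw node_card_N[OF v] by (intro card_subset_eq) auto
  then have "V' \<inter> N v = {u, w}" using uw' z by auto
  then show ?thesis using t V' by blast
qed simp

end

section \<open>Separators of at most two vertices and of three edges\<close>

locale three_connected_circuit = circuit_graph +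
  assumes three_connected: "k_connected 3 V E"
    and no_cutset: "\<not> (\<exists>F. nontrivial_3_edge_cutset V E F)"
    and six: "card V \<ge> 6"
begin

lemma separation:
  assumes "A \<subseteq> V" "B \<subseteq> V" "A \<noteq> {}" "B \<noteq> {}" "A \<inter> B = {}" "card (V - (A \<union> B)) \<le> 2"
  obtains a b where "a \<in> A" "b \<in> B" "{a, b} \<in> E"
proof (rule ccontr)
  assume no: "\<not> thesis"
  define X where "X = V - (A \<union> B)"
  have "connected_graph (V - X) {e \<in> E. e \<inter> X = {}}"
    using three_connected assms(6) by (auto simp: k_connected_def X_def)
  moreover obtain a b where ab: "a \<in> A" "b \<in> B" using assms by auto
  moreover have "a \<in> V - X" "b \<in> V - X" using ab assms by (auto simp: X_def)
  ultimately have "(a, b) \<in> linked {e \<in> E. e \<inter> X = {}}"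
    by (auto simp: connected_graph_def)
  then have "(a, b) \<in> {(x, y). {x, y} \<in> {e \<in> E. e \<inter> X = {}}}\<^sup>*" by (simp add: linked_def)
  then have "b \<in> A"
  proof (induction rule: rtrancl_induct)
    case (step y z)
    then have "{y, z} \<in> E" "z \<notin> X" by auto
    moreover have "z \<in> V" using edge_subset[OF \<open>{y, z} \<in> E\<close>] by auto
    ultimately show ?case using no that step.IH by (auto simp: X_def)
  qed (use ab in simp)
  then show False using ab assms by auto
qed

lemma linked_in_tight:
  assumes "tight X" "x \<in> X" "y \<in> X" "\<And>e. e \<in> E \<Longrightarrow> e \<subseteq> X \<Longrightarrow> e \<in> E'"
  shows "(x, y) \<in> linked E'"
proof -
  define R where "R = {z \<in> X. (x, z) \<in> linked E'}"
  have xR: "x \<in> R" using assms by (simp add: R_def linked_def)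
  have "R = X"
  proof (rule ccontr)
    assume "R \<noteq> X"
    then obtain a b where ab: "a \<in> R" "b \<in> X - R" "{a, b} \<in> E"
      using tight_connected[OF assms(1), of R] xR by (auto simp: R_def)
    then have "{a, b} \<in> E'" using assms(4) by (auto simp: R_def)
    then have "(x, b) \<in> linked E'"
      using ab(1) by (auto simp: R_def linked_def intro: rtrancl_into_rtrancl)
    then show False using ab by (auto simp: R_def)
  qed
  then show ?thesis using assms(3) by (auto simp: R_def)
qed

text \<open>
  If both sides were tight, exactly three edges would run between them. Both sides are connected, so
  these three edges would form a non-trivial cutset.
\<close>

lemma complement_not_tight:
  assumes "tight X" "2 \<le> card X" "card X + 2 \<le> card V"
  shows "\<not> tight (V - X)"
proof
  assume t: "tight (V - X)"
  define F where "F = cross X (V - X)"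
  note X = tightD[OF assms(1)]
  have XV: "X \<union> (V - X) = V" "X \<inter> (V - X) = {}" using X by auto
  have "int (card F) = 3"
    using edges_in_Un_Int[of X "V - X", unfolded XV] X(4) tightD(4)[OF t] edges_in_V
      card_compl_int[OF X(1)] edges_in_empty
    unfolding F_def by linarith
  then have F: "card F = 3" "F \<subseteq> E" by (auto simp: F_def cross_def)
  have stay: "y \<in> X \<longleftrightarrow> x \<in> X" if "(x, y) \<in> linked (E - F)" for x y
    using that unfolding linked_def
  proof (induction rule: rtrancl_induct)
    case (step y z)
    then have "{y, z} \<in> E" "{y, z} \<notin> F" by auto
    moreover have "{y, z} \<subseteq> V" using edge_subset calculation by blast
    ultimately show ?case using step.IH by (auto simp: F_def cross_def)
  qed simp
  have l1: "(x, y) \<in> linked (E - F)" if "x \<in> X" "y \<in> X" for x y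
    using linked_in_tight[OF assms(1) that] by (auto simp: F_def cross_def)
  have l2: "(x, y) \<in> linked (E - F)" if "x \<in> V - X" "y \<in> V - X" for x y
    using linked_in_tight[OF t that] by (auto simp: F_def cross_def)
  let ?r = "linked (E - F) \<inter> V \<times> V"
  have c1: "?r `` {x} = X" if "x \<in> X" for x using that stay l1 X by blast
  have c2: "?r `` {x} = V - X" if "x \<in> V - X" for x using that stay l2 X by blast
  have "components_graph V (E - F) = (\<lambda>x. ?r `` {x}) ` V"
    by (auto simp: components_graph_def quotient_def)
  also have "\<dots> = (\<lambda>x. ?r `` {x}) ` (X \<union> (V - X))" by (simp only: XV)
  also have "\<dots> = {X, V - X}"
  proof -
    have "(\<lambda>x. ?r `` {x}) ` X = {X}" using c1 X(2) by (auto simp: image_iff)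
    moreover have "(\<lambda>x. ?r `` {x}) ` (V - X) = {V - X}"
      using c2 tightD(2)[OF t] by (auto simp: image_iff)
    ultimately show ?thesis unfolding image_Un by auto
  qed
  finally have C: "components_graph V (E - F) = {X, V - X}" .
  have "X \<noteq> V - X" using X by auto
  moreover have "2 \<le> card (V - X)" using assms(3) card_compl_int[OF X(1)] by linarith
  ultimately have "nontrivial_3_edge_cutset V E F"
    using F C assms(2) by (simp add: nontrivial_3_edge_cutset_def)
  then show False using no_cutset by blast
qed

text \<open>
  The two bounds make a tight set one side of a potential non-trivial cutset, so that the absence of
  such cutsets says something about it.
\<close>

definition nontrivial_tight :: "'a set \<Rightarrow> bool" where
  "nontrivial_tight X \<longleftrightarrow> tight X \<and> 2 \<le> card X \<and> card X + 2 \<le> card V"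

lemma deficit_nontrivial_tight:
  assumes "nontrivial_tight X" shows "deficit X \<le> 0"
proof -
  have t: "tight X" using assms by (simp add: nontrivial_tight_def)
  note X = tightD[OF t]
  have "\<not> tight (V - X)" using assms complement_not_tight by (simp add: nontrivial_tight_def)
  then have "edges_in (V - X) < 2 * int (card (V - X)) - 2"
    using tightI[of "V - X"] X by force
  then show ?thesis using deficit_eq[OF X(1)] X(4) edges_in_V card_compl_int[OF X(1)] by linarith
qed

section \<open>Why a node is not admissible\<close>

text \<open>
  One pair of neighbours blocked by a tight set forces this for the other pairs. If \<^term>\<open>{u, z}\<close>
  were blocked only by an edge, then that edge would run between the blocking sets of
  \<^term>\<open>{u, w}\<close> and \<^term>\<open>{w, z}\<close>; and if \<^term>\<open>{w, z}\<close> were an edge as well, the set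
  \<^term>\<open>S\<close> together with \<^term>\<open>v\<close> and \<^term>\<open>z\<close> would have so many edges that it is
  \<^term>\<open>V\<close>, and \<^term>\<open>u\<close> and \<^term>\<open>w\<close> would separate \<^term>\<open>v\<close> and \<^term>\<open>z\<close> from the
  other vertices.
\<close>

lemma third_blocking_set:
  assumes v: "node V E v" and N: "N v = {u, w, z}" "u \<noteq> w" "u \<noteq> z" "w \<noteq> z"
    and S: "tight S" "v \<notin> S" "S \<inter> N v = {u, w}"
    and na: "\<not> admissible_node V E v"
  shows "\<exists>T. tight T \<and> v \<notin> T \<and> T \<inter> N v = {u, z}"
proof (rule ccontr)
  assume no: "\<not> ?thesis"
  have pair: "{x, y} \<in> E \<or> (\<exists>S. tight S \<and> v \<notin> S \<and> S \<inter> N v = {x, y})"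
    if "x \<in> N v" "y \<in> N v" "x \<noteq> y" for x y
    using non_admissible_pair_obstruction[OF v that] na v that unfolding admissible_node_def by blast
  have uz: "{u, z} \<in> E" using pair[of u z] N no by auto
  have wz: "{w, z} \<in> E"
  proof (rule ccontr)
    assume "{w, z} \<notin> E"
    then obtain T where "tight T" "v \<notin> T" "T \<inter> N v = {w, z}" using pair[of w z] N by auto
    then have "{z, u} \<notin> E" using N S
      by (intro blocking_sets_cover(2)[OF v, of z u S T]) auto
    then show False using uz by (simp add: insert_commute)
  qed
  note t = tightD[OF S(1)]
  have vV: "v \<in> V" and zV: "z \<in> V" and zv: "z \<noteq> v"
    using v N neighbours_subset[of v] not_self_neighbour[of v] by (auto simp: node_def)
  have zS: "z \<notin> S" using S(3) N by auto
  have "N v \<inter> S = {u, w}" using S(3) by auto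
  then have e1: "edges_in (insert v S) = edges_in S + 2"
    using edges_in_insert[OF S(2)] N(2) by simp
  have uw: "u \<in> S" "w \<in> S" using S(3) by auto
  have "v \<noteq> u" "v \<noteq> w" using uw S(2) by blast+
  then have three: "card {u, w, v} = 3" using N(2) by simp
  have subz: "{u, w, v} \<subseteq> N z \<inter> insert v S"
    using uw uz wz N(1) neighbours_sym[of z v] by (auto simp: neighbours_def)
  have e2: "edges_in (insert z (insert v S)) = edges_in S + 2 + int (card (N z \<inter> insert v S))"
    using edges_in_insert[of z "insert v S"] e1 zS zv by simp
  have "card (N z \<inter> insert v S) \<ge> 3" using card_mono[OF _ subz] three by simp
  then have VV: "insert z (insert v S) = V"
    using e2 t vV zV zS zv S(2) by (intro dense_eq_V) auto
  then have cV: "card V = card S + 2" using t zS zv S(2) by auto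
  then have "card (N z \<inter> insert v S) = 3"
    using e2 t(4) edges_in_V VV by simp
  then have Nz: "N z \<inter> insert v S = {u, w, v}" using subz three by (metis card_subset_eq finite_N finite_Int)
  have "card (S - {u, w}) \<ge> 2" using cV six uw N(2) t(5) by (simp add: card_Diff_subset)
  then have ne: "S - {u, w} \<noteq> {}" by force
  have "V - ({v, z} \<union> (S - {u, w})) \<subseteq> {u, w}" using VV by auto
  then have "card (V - ({v, z} \<union> (S - {u, w}))) \<le> card {u, w}" by (intro card_mono) auto
  then have "card (V - ({v, z} \<union> (S - {u, w}))) \<le> 2" using N(2) by simp
  then obtain a b where ab: "a \<in> {v, z}" "b \<in> S - {u, w}" "{a, b} \<in> E"
    using separation[of "{v, z}" "S - {u, w}"] ne vV zV t(1) zS S(2) by auto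
  then have "b \<in> N a" by (simp add: neighbours_def insert_commute)
  then show False using ab N(1) zS Nz S(2) by auto
qed

lemma non_admissible_cases:
  assumes v: "node V E v" and na: "\<not> admissible_node V E v"
  shows "clique_blocked v \<or> tight_blocked v"
proof (cases "clique_blocked v")
  case False
  then obtain u w where uw: "u \<in> N v" "w \<in> N v" "u \<noteq> w" "{u, w} \<notin> E"
    using v by (auto simp: clique_blocked_def)
  then obtain S where S: "tight S" "v \<notin> S" "S \<inter> N v = {u, w}"
    using non_admissible_pair_obstruction[OF v uw(1-3)] na v unfolding admissible_node_def by blast
  have "card (N v - {u, w}) = 1" using node_card_N[OF v] uw by (simp add: card_Diff_subset)
  then obtain z where "N v - {u, w} = {z}" by (auto simp: card_1_singleton_iff)
  then have N: "N v = {u, w, z}" "u \<noteq> w" "u \<noteq> z" "w \<noteq> z" using uw by auto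
  have "\<exists>T. tight T \<and> v \<notin> T \<and> T \<inter> N v = {u, z}"
    using third_blocking_set[OF v N S na] .
  moreover have "\<exists>T. tight T \<and> v \<notin> T \<and> T \<inter> N v = {w, z}"
    using third_blocking_set[of v w u z S] v N S na by (auto simp: insert_commute)
  moreover have "N v - {u} = {w, z}" "N v - {w} = {u, z}" "N v - {z} = {u, w}" using N by auto
  ultimately have "\<forall>x\<in>{u, w, z}. \<exists>T. tight T \<and> v \<notin> T \<and> T \<inter> N v = N v - {x}"
    using S by auto
  then show ?thesis using v N(1) by (simp add: tight_blocked_def)
qed simp

lemma admissible_next_to_tight_blocked:
  assumes "node V E y" "\<not> tight_blocked y" "tight_blocked p" "y \<in> N p"
  shows "admissible_node V E y"
  using assms non_admissible_cases clique_blocked_not_adjacent by blast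

section \<open>Nodes whose neighbours form a triangle\<close>

lemma clique_nontrivial_tight:
  assumes "clique_blocked v"
  shows "nontrivial_tight (insert v (N v))" "card (insert v (N v)) = 4"
proof -
  have v: "node V E v" and adj: "\<And>u w. u \<in> N v \<Longrightarrow> w \<in> N v \<Longrightarrow> u \<noteq> w \<Longrightarrow> {u, w} \<in> E"
    using assms by (auto simp: clique_blocked_def)
  show c: "card (insert v (N v)) = 4" using node_card_N[OF v] not_self_neighbour by simp
  have sub: "insert v (N v) \<subseteq> V" using v neighbours_subset by (auto simp: node_def)
  have "card (N x \<inter> N v) = 2" if "x \<in> N v" for x
  proof -
    have "N x \<inter> N v = N v - {x}"
    proof
      show "N v - {x} \<subseteq> N x \<inter> N v" using that adj[of _ x] by (simp add: neighbours_def subset_iff)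
    qed (use not_self_neighbour[of x] in auto)
    then show ?thesis using that node_card_N[OF v] by simp
  qed
  then have "2 * edges_in (N v) = 6"
    using sum_inner_degree[OF neighbours_subset[of v]] node_card_N[OF v] by simp
  then have "edges_in (insert v (N v)) = 6"
    using edges_in_insert[OF not_self_neighbour] node_card_N[OF v] by simp
  moreover have "insert v (N v) \<noteq> V" using c six by auto
  ultimately have "tight (insert v (N v))" using c sub by (intro tightI) auto
  then show "nontrivial_tight (insert v (N v))" using c six by (simp add: nontrivial_tight_def)
qed

text \<open>
  Let \<open>K\<close> be the \<open>K\<^sub>4\<close> at \<^term>\<open>v\<close>. If \<open>K\<close> and \<^term>\<open>X\<close> do not cover \<^term>\<open>V\<close>, their
  intersection is tight, hence a single vertex, and their union is tight. Were only one vertex outside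
  the union, then it would form with the common vertex a 2-separator. If they do cover
  \<^term>\<open>V\<close>, then either they share two vertices and no edge crosses, or they share one vertex and
  exactly one edge crosses; both times two vertices separate the graph.
\<close>

lemma clique_Un_nontrivial_tight:
  assumes v: "clique_blocked v" and X: "nontrivial_tight X" "v \<notin> X"
    and meet: "insert v (N v) \<inter> X \<noteq> {}"
  shows "nontrivial_tight (insert v (N v) \<union> X)"
proof -
  define K where "K = insert v (N v)"
  have K: "nontrivial_tight K" "card K = 4" "v \<in> K" using clique_nontrivial_tight[OF v] by (auto simp: K_def)
  have tK: "tight K" and tX: "tight X" and X2: "2 \<le> card X" and Xn: "card X + 2 \<le> card V"
    using K X by (auto simp: nontrivial_tight_def)
  note kd = tightD[OF tK] and xd = tightD[OF tX]
  have meet: "K \<inter> X \<noteq> {}" using meet by (simp add: K_def)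
  have c3: "card (K \<inter> X) \<le> 3"
  proof -
    have "card (K \<inter> X) \<le> card (K - {v})" using X(2) kd(5) by (intro card_mono) auto
    then show ?thesis using K by simp
  qed
  have c0: "card (K \<inter> X) > 0" using meet kd(5) by (simp add: card_gt_0_iff)
  have KX: "card (K - X) = 4 - card (K \<inter> X)" using K(2) kd(5) by (simp add: card_Diff_subset_Int)
  have XK: "card (X - K) = card X - card (K \<inter> X)"
    using xd(5) by (simp add: card_Diff_subset_Int Int_commute)
  have rest: "V - ((K - X) \<union> (X - K)) = (V - (K \<union> X)) \<union> (K \<inter> X)" using kd(1) xd(1) by auto
  have KX_ne: "K - X \<noteq> {}" using K(3) X(2) by auto
  \<comment> \<open>Without a crossing edge, the common vertices and those outside the union separate the graph.\<close>
  have uncrossed: "False" if "cross K X = {}" "card (V - (K \<union> X)) + card (K \<inter> X) \<le> 2"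
  proof -
    have "card (V - ((K - X) \<union> (X - K))) \<le> 2"
      unfolding rest using that(2) card_Un_le[of "V - (K \<union> X)" "K \<inter> X"] by linarith
    moreover have "X - K \<noteq> {}"
    proof
      assume "X - K = {}"
      then have "X = K \<inter> X" by auto
      then have "card X = card (K \<inter> X)" by simp
      then have "card X = 2" using X2 that(2) by linarith
      then show False using tight_card[OF tX] by simp
    qed
    moreover have "K - X \<subseteq> V" "X - K \<subseteq> V" "(K - X) \<inter> (X - K) = {}" using kd(1) xd(1) by auto
    ultimately obtain a b where "a \<in> K - X" "b \<in> X - K" "{a, b} \<in> E"
      using separation[of "K - X" "X - K"] KX_ne by metis
    then show False using cross_edge[of a b K X] that(1) by auto
  qed
  have notV: "K \<union> X \<noteq> V"
  proof
    assume V: "K \<union> X = V"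
    have "V - X = K - X" using V by auto
    then have "card (K - X) \<ge> 2" using Xn card_compl_int[OF xd(1)] by simp
    then have c2: "card (K \<inter> X) \<le> 2" using KX by linarith
    have e: "edges_in (K \<inter> X) = 2 * int (card (K \<inter> X)) - 3 + int (card (cross K X))"
      using tight_Un_eq_V[OF tK tX V] .
    have up: "2 * edges_in (K \<inter> X) \<le> int (card (K \<inter> X)) * (int (card (K \<inter> X)) - 1)"
      using kd(1) by (intro edges_in_upper) auto
    have fc: "finite (cross K X)" by (simp add: cross_def)
    have nc: "cross K X \<noteq> {}" using uncrossed V c2 by auto
    have "card (K \<inter> X) \<noteq> 2"
    proof
      assume "card (K \<inter> X) = 2"
      then have "card (cross K X) = 0" using e up by simp
      then show False using nc fc by simp
    qed
    then have c1: "card (K \<inter> X) = 1" using c0 c2 by linarith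
    then have "card (cross K X) = 1" using e up edges_in_nonneg[of "K \<inter> X"] by simp
    then obtain f where f: "cross K X = {f}" by (auto simp: card_1_singleton_iff)
    then have "f \<in> cross K X" by simp
    then obtain s where s: "s \<in> f" "s \<in> K - X" by (auto simp: cross_def)
    \<comment> \<open>The end \<open>s\<close> of the only crossing edge and the common vertex form the 2-separator.\<close>
    have "card (K - X - {s}) = 2" using s KX c1 by simp
    then have ne1: "K - X - {s} \<noteq> {}" by force
    have "card (X - K) > 0" using XK c1 X2 by simp
    then have ne2: "X - K \<noteq> {}" by force
    have "V - ((K - X - {s}) \<union> (X - K)) = insert s (K \<inter> X)" using V s by auto
    then have "card (V - ((K - X - {s}) \<union> (X - K))) \<le> 2"
      using c1 card_insert_le_m1[of 2 "K \<inter> X" s] by simp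
    moreover have "K - X - {s} \<subseteq> V" "X - K \<subseteq> V" "(K - X - {s}) \<inter> (X - K) = {}"
      using kd(1) xd(1) by auto
    ultimately obtain a b where ab: "a \<in> K - X - {s}" "b \<in> X - K" "{a, b} \<in> E"
      using separation[of "K - X - {s}" "X - K"] ne1 ne2 by metis
    then have "{a, b} = f" using cross_edge[of a b K X] f by auto
    then show False using s ab by auto
  qed
  note u = tight_Un[OF tK tX meet notV]
  have c1: "card (K \<inter> X) = 1" using tight_card[OF u(2)] c3 by linarith
  have "card (V - (K \<union> X)) \<ge> 2"
  proof (rule ccontr)
    assume "\<not> ?thesis"
    then show False using uncrossed[OF u(3)] c1 by simp
  qed
  then have "card (K \<union> X) + 2 \<le> card V" using card_compl_int[of "K \<union> X"] kd(1) xd(1) by auto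
  moreover have "2 \<le> card (K \<union> X)" using K(2) card_mono[of "K \<union> X" K] kd(5) xd(5) by auto
  ultimately show ?thesis using u(1) by (simp add: nontrivial_tight_def K_def)
qed

section \<open>Admissible nodes outside a tight set\<close>

text \<open>
  These sets arise as disjoint unions of tight sets. The definition keeps only what is needed of such a
  union: its deficit, and that each remaining clique is disjoint from it and so can be added next.
\<close>

definition absorbing :: "'a set \<Rightarrow> bool" where
  "absorbing U \<longleftrightarrow> U \<subseteq> V \<and> deficit U \<le> 0 \<and>
     (\<forall>v\<in>V - U. clique_blocked v \<longrightarrow> insert v (N v) \<inter> U = {})"

lemma largest_subset_of_V:
  assumes "P X" "\<And>Y. P Y \<Longrightarrow> Y \<subseteq> V"
  shows "\<exists>Y. P Y \<and> (\<forall>Z. P Z \<longrightarrow> card Z \<le> card Y)"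
proof -
  have "\<forall>Y. P Y \<longrightarrow> card Y < Suc (card V)"
    using assms(2) by (simp add: card_mono less_Suc_eq_le)
  then show ?thesis using ex_has_greatest_nat[of P X card] assms(1) by blast
qed

text \<open>
  Enlarge \<^term>\<open>Z\<close> to a largest tight set disjoint from \<^term>\<open>U\<close> before adding it. A clique that
  meets the enlarged set has all its vertices outside \<^term>\<open>U\<close>, so merging it with that set
  contradicts the choice.
\<close>

lemma absorbing_extend:
  assumes U: "absorbing U" and Z: "nontrivial_tight Z" "Z \<inter> U = {}"
  obtains U' where "absorbing U'" "U \<union> Z \<subseteq> U'"
proof -
  let ?P = "\<lambda>X. nontrivial_tight X \<and> Z \<subseteq> X \<and> X \<inter> U = {}"
  have "\<exists>X. ?P X \<and> (\<forall>Y. ?P Y \<longrightarrow> card Y \<le> card X)"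
    by (rule largest_subset_of_V[of ?P Z]) (use Z in \<open>simp_all add: nontrivial_tight_def tight_def\<close>)
  then obtain X where X: "?P X" and max: "\<And>Y. ?P Y \<Longrightarrow> card Y \<le> card X" by blast
  have XV: "X \<subseteq> V" using X by (simp add: nontrivial_tight_def tight_def)
  have UV: "U \<subseteq> V" using U by (simp add: absorbing_def)
  have "deficit (U \<union> X) \<le> 0"
    using deficit_Un[OF UV XV] X U deficit_nontrivial_tight[of X]
    by (auto simp: absorbing_def Int_commute)
  moreover have "insert v (N v) \<inter> (U \<union> X) = {}" if v: "v \<in> V - (U \<union> X)" "clique_blocked v" for v
  proof (rule ccontr)
    assume ne: "insert v (N v) \<inter> (U \<union> X) \<noteq> {}"
    have KU: "insert v (N v) \<inter> U = {}" using U v by (simp add: absorbing_def)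
    then have "insert v (N v) \<inter> X \<noteq> {}" using ne by blast
    then have "nontrivial_tight (insert v (N v) \<union> X)"
      using clique_Un_nontrivial_tight[OF v(2)] X v(1) by blast
    then have "?P (insert v (N v) \<union> X)" using X KU by blast
    then have "card (insert v (N v) \<union> X) \<le> card X" by (rule max)
    moreover have "card X < card (insert v (N v) \<union> X)"
      using v(1) XV by (intro psubset_card_mono) auto
    ultimately show False by simp
  qed
  ultimately have "absorbing (U \<union> X)" using UV XV by (simp add: absorbing_def)
  then show ?thesis using that X by blast
qed

text \<open>
  A largest absorbing superset of \<^term>\<open>X\<close> contains all nodes blocked by cliques, and its complement has deficit at
  least 2.
\<close>

lemma two_admissible_nodes_outside:
  assumes X: "X = {} \<or> nontrivial_tight X" and free: "\<And>v. v \<in> V - X \<Longrightarrow> \<not> tight_blocked v"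
  shows "2 \<le> card {v \<in> V - X. admissible_node V E v}"
proof -
  let ?P = "\<lambda>U. absorbing U \<and> X \<subseteq> U"
  have empty: "absorbing {}" by (simp add: absorbing_def deficit_def)
  have "\<exists>U. ?P U"
    using X
  proof
    assume "nontrivial_tight X"
    then show ?thesis using absorbing_extend[OF empty, of X] by auto
  qed (use empty in auto)
  then obtain U0 where "?P U0" by blast
  then have "\<exists>U. ?P U \<and> (\<forall>Y. ?P Y \<longrightarrow> card Y \<le> card U)"
    by (rule largest_subset_of_V[of ?P]) (simp add: absorbing_def)
  then obtain U where U: "?P U" and max: "\<And>Y. ?P Y \<Longrightarrow> card Y \<le> card U" by blast
  have UV: "U \<subseteq> V" "deficit U \<le> 0" using U by (auto simp: absorbing_def)
  have no_clique: "\<not> clique_blocked v" if v: "v \<in> V - U" for v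
  proof
    assume c: "clique_blocked v"
    then have "insert v (N v) \<inter> U = {}" using U v by (simp add: absorbing_def)
    then obtain U' where U': "absorbing U'" "U \<union> insert v (N v) \<subseteq> U'"
      using absorbing_extend U clique_nontrivial_tight(1)[OF c] by blast
    then have "card U' \<le> card U" using max[of U'] U by blast
    moreover have "card U < card U'"
      using U' v by (intro psubset_card_mono) (auto simp: absorbing_def)
    ultimately show False by simp
  qed
  let ?A = "{v \<in> V - U. node V E v}"
  have "2 \<le> deficit (V - U)"
    using deficit_Un[of U "V - U"] UV deficit_V by (simp add: Un_absorb1)
  also have "\<dots> \<le> (\<Sum>x\<in>V - U. if node V E x then 1 else 0)"
    unfolding deficit_def
  proof (rule sum_mono)
    fix x assume "x \<in> V - U"
    then show "4 - int (degree E x) \<le> (if node V E x then 1 else 0)"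
      using degree_ge_3[of x] six by (auto simp: node_def)
  qed
  also have "\<dots> = int (card ?A)" by (simp add: sum.If_cases Int_def)
  finally have "2 \<le> card ?A" by simp
  also have "card ?A \<le> card {v \<in> V - X. admissible_node V E v}"
  proof (rule card_mono)
    show "?A \<subseteq> {v \<in> V - X. admissible_node V E v}"
      using non_admissible_cases no_clique free U by blast
  qed simp
  finally show ?thesis .
qed

section \<open>Descending along nodes blocked by tight sets\<close>

text \<open>
  The induction below replaces \<^term>\<open>Q\<close> by its union with a blocking set of \<^term>\<open>p\<close>, which is
  tight only if the two meet. If \<^term>\<open>p\<close> has a neighbour in \<^term>\<open>Q\<close>, then any blocking set
  for a neighbour \<^term>\<open>a\<close> in \<^term>\<open>P\<close> contains it. Otherwise two neighbours in \<^term>\<open>P\<close> are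
  eligible, and since their blocking sets together cover all vertices but \<^term>\<open>p\<close>, one of them
  meets \<^term>\<open>Q\<close>.
\<close>

lemma blocking_set_reaching:
  assumes p: "tight_blocked p" "p \<in> P"
    and Q: "Q = V - P" "tight Q" "card (N p \<inter> Q) \<le> 1"
    and few: "card (N p \<inter> {w \<in> P. tight_blocked w}) \<le> 1"
  obtains a S where "a \<in> N p" "a \<in> P" "\<not> tight_blocked a" "tight S" "p \<notin> S"
    "S \<inter> N p = N p - {a}" "S \<inter> Q \<noteq> {}"
proof -
  let ?W = "{w \<in> P. tight_blocked w}"
  have node: "node V E p" using p by (simp add: tight_blocked_def)
  have blk: "\<exists>S. tight S \<and> p \<notin> S \<and> S \<inter> N p = N p - {a}" if "a \<in> N p" for a
    using p that by (simp add: tight_blocked_def)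
  have N3: "card (N p) = 3" using node_card_N[OF node] .
  let ?F = "{a \<in> N p. a \<in> P \<and> \<not> tight_blocked a}"
  have Nsplit: "N p = (N p \<inter> Q) \<union> (N p \<inter> ?W) \<union> ?F"
    using neighbours_subset[of p] Q(1) by auto
  have "card (N p) \<le> card (N p \<inter> Q) + card (N p \<inter> ?W) + card ?F"
    by (subst Nsplit) (meson card_Un_le add_le_mono1 order_trans)
  then have sum: "3 \<le> card (N p \<inter> Q) + 1 + card ?F" using N3 few by linarith
  show ?thesis
  proof (cases "N p \<inter> Q = {}")
    case True
    then have "2 \<le> card ?F" using sum by simp
    then obtain a b where ab: "a \<in> ?F" "b \<in> ?F" "a \<noteq> b"
      by (rule two_distinct)
    obtain S T where S: "tight S" "p \<notin> S" "S \<inter> N p = N p - {a}"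
      and T: "tight T" "p \<notin> T" "T \<inter> N p = N p - {b}"
      using blk[of a] blk[of b] ab by blast
    have "S \<union> T = V - {p}" using blocking_sets_cover(1)[OF node _ _ ab(3) S T] ab by blast
    moreover have "Q \<noteq> {}" "Q \<subseteq> V - {p}" using Q p(2) tightD(2) by auto
    ultimately have "S \<inter> Q \<noteq> {} \<or> T \<inter> Q \<noteq> {}" by blast
    then show ?thesis
    proof
      assume "S \<inter> Q \<noteq> {}"
      then show ?thesis using that[OF _ _ _ S] ab(1) by simp
    next
      assume "T \<inter> Q \<noteq> {}"
      then show ?thesis using that[OF _ _ _ T] ab(2) by simp
    qed
  next
    case False
    then obtain q where q: "q \<in> N p" "q \<in> Q" by blast
    have "?F \<noteq> {}" using sum Q(3) by force
    then obtain a where a: "a \<in> N p" "a \<in> P" "\<not> tight_blocked a" by blast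
    obtain S where S: "tight S" "p \<notin> S" "S \<inter> N p = N p - {a}" using blk[OF a(1)] by blast
    have "q \<noteq> a" using q a Q(1) by blast
    then have "q \<in> S \<inter> Q" using q S(3) by blast
    then show ?thesis using that[OF a S] by blast
  qed
qed

text \<open>
  Induction on \<^term>\<open>card P\<close>. Let \<open>Q\<close> be the complement of \<^term>\<open>P\<close>. If \<^term>\<open>P\<close> contains nodes
  blocked by tight sets, choose one, \<open>p\<close>, with at most one neighbour of this kind in
  \<^term>\<open>P\<close>. If \<open>p\<close> has two neighbours in \<open>Q\<close>, then \<open>Q\<close> stays tight when \<open>p\<close> is added, so \<open>p\<close> can be
  removed from \<^term>\<open>P\<close>. Otherwise \<open>Q\<close> grows by \<open>p\<close> and a blocking set of \<open>p\<close> that misses a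
  neighbour not of this kind. Either way the smaller part keeps a vertex that is not blocked by tight
  sets, which is why the hypothesis asks for one; a part consisting only of nodes blocked by tight
  sets contains no admissible node.
\<close>

lemma admissible_node_in_part:
  assumes "P \<subseteq> V" "tight (V - P)" "2 \<le> card (V - P)" "2 \<le> card P"
    and "\<exists>y\<in>P. \<not> tight_blocked y"
  shows "\<exists>v\<in>P. admissible_node V E v"
  using assms
proof (induction "card P" arbitrary: P rule: less_induct)
  case less
  define Q where "Q = V - P"
  define W where "W = {w \<in> P. tight_blocked w}"
  have Q: "tight Q" "2 \<le> card Q" "Q \<inter> P = {}" using less.prems by (auto simp: Q_def)
  have finP: "finite P" using less.prems by simp
  show ?case
  proof (cases "W = {}")
    case True
    have "card Q + 2 \<le> card V"
      using less.prems card_compl_int[of P] by (simp add: Q_def)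
    then have "nontrivial_tight Q" using Q by (simp add: nontrivial_tight_def)
    moreover have PQ: "V - Q = P" using less.prems by (auto simp: Q_def)
    ultimately have "2 \<le> card {v \<in> P. admissible_node V E v}"
      using two_admissible_nodes_outside[of Q] True by (auto simp: W_def)
    then have "{v \<in> P. admissible_node V E v} \<noteq> {}" by force
    then show ?thesis by blast
  next
    case False
    have WV: "W \<subseteq> V" "W \<noteq> V" using less.prems by (auto simp: W_def)
    have Wn: "\<And>w. w \<in> W \<Longrightarrow> node V E w" by (simp add: W_def tight_blocked_def)
    obtain p where p: "p \<in> W" and few: "card (N p \<inter> W) \<le> 1"
      using node_with_few_neighbours_in[OF WV(1) False WV(2) Wn] by blast
    have pP: "p \<in> P" "tight_blocked p" "p \<in> V" "p \<notin> Q"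
      using p less.prems(1) by (auto simp: W_def Q_def)
    have N3: "card (N p) = 3" using node_card_N tight_blocked_node pP(2) by blast
    \<comment> \<open>A smaller part may be a single vertex, to which the induction hypothesis does not apply. It is
      then a node next to \<open>p\<close>, hence admissible.\<close>
    have shrink: ?thesis
      if P': "P' \<subset> P" "tight (V - P')" and a: "a \<in> P'" "\<not> tight_blocked a"
        and near: "N p \<inter> P' \<noteq> {}"
      for P' a
    proof (cases "card P' = 1")
      case True
      then have P1: "P' = {a}" using a(1) by (auto simp: card_1_singleton_iff)
      then have "a \<in> N p" using near by auto
      moreover have "node V E a" using tight_delete_node P' P1 less.prems(1) by blast
      ultimately have "admissible_node V E a"
        using admissible_next_to_tight_blocked a(2) pP(2) by blast
      then show ?thesis using a P' by blast
    next
      case False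
      have fin': "finite P'" using P' finP by (auto intro: finite_subset)
      have "card P' \<noteq> 0" using fin' a by auto
      then have "2 \<le> card P'" using False by linarith
      moreover have "card P' < card P" using P' finP by (simp add: psubset_card_mono)
      moreover have "card (V - P) \<le> card (V - P')" using P' by (intro card_mono) auto
      ultimately have "\<exists>v\<in>P'. admissible_node V E v"
        using less.hyps[of P'] P' a less.prems(1,3) by auto
      then show ?thesis using P' by blast
    qed
    show ?thesis
    proof (cases "2 \<le> card (N p \<inter> Q)")
      case True
      obtain y where y: "y \<in> P" "\<not> tight_blocked y" using less.prems(5) by blast
      have yp: "y \<noteq> p" using y pP by blast
      have ins: "insert p Q = V - (P - {p})" using pP less.prems(1) by (auto simp: Q_def)
      have "y \<notin> insert p Q" using y yp by (simp add: Q_def)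
      then have neV: "insert p Q \<noteq> V" using y(1) less.prems(1) by blast
      then have t: "tight (V - (P - {p}))"
        using tight_insert[OF Q(1) _ True] pP ins by simp
      have "\<not> N p \<subseteq> Q"
      proof
        assume "N p \<subseteq> Q"
        then have "N p \<inter> Q = N p" by auto
        then show False using tight_contains_neighbours[OF Q(1), of p] pP N3 neV by simp
      qed
      then have "N p \<inter> (P - {p}) \<noteq> {}"
        using neighbours_subset[of p] not_self_neighbour[of p] by (auto simp: Q_def)
      then show ?thesis using shrink[of "P - {p}" y] t y yp pP by blast
    next
      case False
      then have le1: "card (N p \<inter> Q) \<le> 1" by simp
      obtain a S where a: "a \<in> N p" "a \<in> P" "\<not> tight_blocked a"
        and S: "tight S" "p \<notin> S" "S \<inter> N p = N p - {a}" "S \<inter> Q \<noteq> {}"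
        using blocking_set_reaching[OF pP(2,1) Q_def Q(1) le1] few unfolding W_def by blast
      have ap: "a \<noteq> p" using a(1) not_self_neighbour by blast
      have aSQ: "a \<notin> S \<union> Q" using S(3) a by (auto simp: Q_def)
      have aV: "a \<in> V" using a less.prems(1) by blast
      have t: "tight (S \<union> Q)" using tight_Un(1)[OF S(1) Q(1) S(4)] aSQ aV by blast
      have "card (N p - {a}) \<le> card (N p \<inter> (S \<union> Q))"
        using S(3) by (intro card_mono) auto
      then have two: "2 \<le> card (N p \<inter> (S \<union> Q))" using N3 a(1) by simp
      have "insert p (S \<union> Q) \<noteq> V" using aSQ aV ap by blast
      then have t': "tight (insert p (S \<union> Q))"
        using tight_insert[OF t _ two] pP S(2) by blast
      define P' where "P' = V - insert p (S \<union> Q)"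
      have "V - P' = insert p (S \<union> Q)" using tightD(1)[OF t'] by (auto simp: P'_def)
      moreover have "P' \<subset> P" using pP by (auto simp: P'_def Q_def)
      moreover have "a \<in> P'" using aSQ aV ap by (simp add: P'_def)
      ultimately show ?thesis using shrink[of P' a] t' a by auto
    qed
  qed
qed

section \<open>Two admissible nodes\<close>

theorem two_admissible_nodes: "2 \<le> card {v \<in> V. admissible_node V E v}"
proof (cases "\<exists>v. tight_blocked v")
  case False
  then show ?thesis using two_admissible_nodes_outside[of "{}"] by simp
next
  case True
  define W where "W = {w. tight_blocked w}"
  have Wn: "\<And>w. w \<in> W \<Longrightarrow> node V E w" by (simp add: W_def tight_blocked_def)
  have WV: "W \<subseteq> V" using Wn by (auto simp: node_def)
  have "W \<noteq> V"
  proof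
    assume "W = V"
    then have "deficit V = int (card V)" using Wn by (simp add: deficit_def node_def)
    then show False using deficit_V six by simp
  qed
  then obtain v where v: "v \<in> W" and few: "card (N v \<inter> W) \<le> 1"
    using node_with_few_neighbours_in[OF WV _ _ Wn] True by (auto simp: W_def)
  have tb: "tight_blocked v" and node: "node V E v" and vV: "v \<in> V"
    using v Wn WV by (auto simp: W_def)
  have "2 \<le> card (N v - W)"
    using few node_card_N[OF node] card_Diff_subset_Int[of "N v" W] by simp
  then obtain a b where ab: "a \<in> N v - W" "b \<in> N v - W" "a \<noteq> b"
    by (rule two_distinct)
  have blk: "\<exists>S. tight S \<and> v \<notin> S \<and> S \<inter> N v = N v - {c}" if "c \<in> N v" for c
    using tb that by (simp add: tight_blocked_def)
  obtain S T where S: "tight S" "v \<notin> S" "S \<inter> N v = N v - {a}"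
    and T: "tight T" "v \<notin> T" "T \<inter> N v = N v - {b}"
    using blk[of a] blk[of b] ab by blast
  have cover: "S \<union> T = V - {v}" using blocking_sets_cover(1)[OF node _ _ ab(3) S T] ab by blast
  \<comment> \<open>The part cut off by \<open>v\<close> and a blocking set contains the neighbour \<open>c\<close> outside \<open>W\<close>.\<close>
  have part: "\<exists>x\<in>V - insert v R. admissible_node V E x"
    if c: "c \<in> N v - W" and R: "tight R" "v \<notin> R" "R \<inter> N v = N v - {c}" for c R
  proof -
    define P where "P = V - insert v R"
    have cP: "c \<in> P" using c R(2,3) neighbours_subset[of v] not_self_neighbour[of v] unfolding P_def by blast
    have VP: "V - P = insert v R" using tightD(1)[OF R(1)] vV unfolding P_def by blast
    have "insert v R \<noteq> V" using cP by (auto simp: P_def)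
    moreover have "N v \<inter> R = N v - {c}" using R(3) by blast
    then have "2 \<le> card (N v \<inter> R)" using node_card_N[OF node] c by simp
    ultimately have t: "tight (V - P)"
      unfolding VP using tight_insert[OF R(1)] R(2) vV by blast
    have "\<exists>x\<in>P. admissible_node V E x"
    proof (cases "card P = 1")
      case True
      then have P1: "P = {c}" using cP by (auto simp: card_1_singleton_iff)
      then have "node V E c" using tight_delete_node[of c] t c neighbours_subset[of v] by auto
      then have "admissible_node V E c"
        using admissible_next_to_tight_blocked[OF _ _ tb] c by (auto simp: W_def)
      then show ?thesis using cP by blast
    next
      case False
      have PV: "P \<subseteq> V" by (simp add: P_def)
      then have "card P \<noteq> 0" using cP by auto
      then have "2 \<le> card P" using False by linarith
      moreover have "2 \<le> card (V - P)"
      proof -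
        have "card R > 0" using tightD[OF R(1)] by (simp add: card_gt_0_iff)
        then show ?thesis unfolding VP using R(2) tightD(5)[OF R(1)] by simp
      qed
      ultimately show ?thesis using admissible_node_in_part[OF PV t] cP c by (auto simp: W_def)
    qed
    then show ?thesis by (simp add: P_def)
  qed
  obtain x where x: "x \<in> V - insert v S" "admissible_node V E x" using part[OF ab(1) S] by blast
  obtain y where y: "y \<in> V - insert v T" "admissible_node V E y" using part[OF ab(2) T] by blast
  have "x \<noteq> y" using x y cover by blast
  then have "card {x, y} = 2" by simp
  moreover have "card {x, y} \<le> card {v \<in> V. admissible_node V E v}"
    using x y by (intro card_mono) auto
  ultimately show ?thesis by simp
qed

end

theorem theorem1p1:
  fixes V :: "'a set" and E :: "'a set set"
  assumes "circuit V E"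
    and "k_connected 3 V E"
    and "\<not> (\<exists>F. nontrivial_3_edge_cutset V E F)"
    and "card V \<ge> 6"
  shows "card {v \<in> V. admissible_node V E v} \<ge> 2"
proof -
  interpret three_connected_circuit V E
    using assms by unfold_locales
  show ?thesis by (rule two_admissible_nodes)
qed

end
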